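(* Let $x\in[D]^T$ be a document of length $T$. Let $m_{\max}=\max_{j\in[D]}m_j(x)$ be the maximal word multiplicity in $x$, let $v_{\max}=\max_{j\in[D]}v_j$, and let $v_{\min}$ be the minimum of $v_j$ over the words $j$ appearing in $x$. Let $S\subseteq[T]$ be such that $$|S|\le\frac{T\,\|\varphi(x)\|}{4\,m_{\max}\,v_{\max}},$$ and let $\tilde x\in B_S(x)$. Then the normalized TF-IDF transform $\phi$ satisfies $$\|\phi(x)-\phi(\tilde x)\|\le\frac{4\,m_{\max}^{1/2}\,v_{\max}^{1/2}\,D^{1/4}}{v_{\min}^{1/2}}\sqrt{\frac{|S|}{T}}.$$
   Context: Notation: $\|\cdot\|$ is the Euclidean norm, $[n]=\{1,\dots,n\}$. The dictionary of words is $[D]$, and a document of length $T\ge1$ is an element $x=(x_1,\dots,x_T)\in[D]^T$. For $x\in[D]^T$ and $S\subseteq[T]$, $B_S(x)=\{\tilde x\in[D]^T:\tilde x_t=x_t\text{ for all }t\notin S\}$. TF-IDF: $m_j(x)=|\{t\in[T]:x_t=j\}|$ is the multiplicity of word $j$ in $x$. A fixed finite set (corpus) $\mathcal C$ of documents is given, and $v_j=\log\frac{|\mathcal C|}{|\{z\in\mathcal C:j\in z\}|}$ is the inverse document frequency of $j$; it is assumed that $v_j$ is well defined (finite) and $v_j>0$ for every $j\in[D]$. The non-normalized TF-IDF of $x\in[D]^T$ is $\varphi(x)\in\mathbb{R}^D$ with $\varphi(x)_j=\frac{m_j(x)}{T}v_j$, and the normalized TF-IDF is $\phi(x)=\varphi(x)/\|\varphi(x)\|$.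 *)

theory Defs
  imports "HOL-Analysis.Analysis"
begin

text \<open>
  The dictionary \<open>[D]\<close> is a finite type \<open>'w\<close> with \<open>D = CARD('w)\<close>, so that
  \<open>\<real>\<^sup>D\<close> with its Euclidean norm is \<^typ>\<open>real ^ 'w\<close>. Documents are lists of words; positions
  \<open>[T]\<close> are numbered from 0, as list indices are.
\<close>

definition documents :: "nat \<Rightarrow> 'w list set" where
  "documents T = {x. length x = T}"

definition perturbations :: "nat set \<Rightarrow> 'w list \<Rightarrow> 'w list set" where
  "perturbations S x =
     {y \<in> documents (length x). \<forall>t<length x. t \<notin> S \<longrightarrow> y ! t = x ! t}"

definition multiplicity_of :: "'w list \<Rightarrow> 'w \<Rightarrow> nat" where
  "multiplicity_of x j = card {t. t < length x \<and> x ! t = j}"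

definition idf :: "'w list set \<Rightarrow> 'w \<Rightarrow> real" where
  "idf \<C> j = ln (real (card \<C>) / real (card {z \<in> \<C>. j \<in> set z}))"

text \<open>
  Since division by zero is total here, finiteness of the inverse document frequency of \<open>j\<close>
  is expressed by requiring that \<open>j\<close> occurs in some document of the corpus.
\<close>

definition valid_corpus :: "'w list set \<Rightarrow> bool" where
  "valid_corpus \<C> \<longleftrightarrow>
     finite \<C> \<and> (\<forall>z\<in>\<C>. length z \<ge> 1) \<and>
     (\<forall>j. {z \<in> \<C>. j \<in> set z} \<noteq> {}) \<and> (\<forall>j. idf \<C> j > 0)"

definition tfidf :: "'w list set \<Rightarrow> 'w::finite list \<Rightarrow> real ^ 'w" where
  "tfidf \<C> x = (\<chi> j. real (multiplicity_of x j) / real (length x) * idf \<C> j)"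

definition normalized_tfidf :: "'w list set \<Rightarrow> 'w::finite list \<Rightarrow> real ^ 'w" where
  "normalized_tfidf \<C> x = tfidf \<C> x /\<^sub>R norm (tfidf \<C> x)"

definition max_multiplicity :: "'w::finite list \<Rightarrow> nat" where
  "max_multiplicity x = Max (range (multiplicity_of x))"

definition max_idf :: "'w::finite list set \<Rightarrow> real" where
  "max_idf \<C> = Max (range (idf \<C>))"

definition min_idf :: "'w list set \<Rightarrow> 'w list \<Rightarrow> real" where
  "min_idf \<C> x = Min (idf \<C> ` set x)"

end

theory Submission
  imports Defs
begin

text \<open>
  Normalization is Lipschitz away from the origin with constant \<open>2 / \<parallel>\<phi>(x)\<parallel>\<close>, and changing the
  words in \<open>S\<close> moves the unnormalized transform by at most \<open>2 v\<^sub>m\<^sub>a\<^sub>x |S| / T\<close>. Hence the distance is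
  at most \<open>q = 4 v\<^sub>m\<^sub>a\<^sub>x |S| / (T \<parallel>\<phi>(x)\<parallel>)\<close>. The assumption on \<open>|S|\<close> says
  \<open>q \<le> 1 / m\<^sub>m\<^sub>a\<^sub>x \<le> 1\<close>, so \<open>q \<le> \<surd>q\<close>, and the multiplicities sum to \<open>T\<close>, which by
  Cauchy-Schwarz gives \<open>\<parallel>\<phi>(x)\<parallel> \<ge> v\<^sub>m\<^sub>i\<^sub>n / \<surd>D\<close>.
\<close>

text \<open>Write the difference as \<open>(a - b) /\<^sub>R norm a\<close> plus a multiple of
  \<open>b\<close>. By the reverse triangle inequality the second term is also at most
  \<open>norm (a - b) / norm a\<close>. The bound involves \<open>norm a\<close> alone, so the
  perturbed transform needs no lower bound of its own.\<close>

lemma norm_diff_normalized_le: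
  fixes a b :: "'a::real_normed_vector"
  assumes "a \<noteq> 0"
  shows "norm (a /\<^sub>R norm a - b /\<^sub>R norm b) \<le> 2 * norm (a - b) / norm a"
proof (cases "b = 0")
  \<comment> \<open>Here \<open>b /\<^sub>R norm b\<close> is 0, since \<open>inverse 0 = 0\<close>,
    and the claim reads 1 \<le> 2.\<close>
  case True
  then show ?thesis using assms by simp
next
  case False
  have "a /\<^sub>R norm a - b /\<^sub>R norm b
      = (a - b) /\<^sub>R norm a + (inverse (norm a) - inverse (norm b)) *\<^sub>R b"
    by (simp add: algebra_simps)
  then have "norm (a /\<^sub>R norm a - b /\<^sub>R norm b)
      \<le> norm (a - b) / norm a + \<bar>inverse (norm a) - inverse (norm b)\<bar> * norm b"
    using norm_triangle_ineq[of "(a - b) /\<^sub>R norm a" "(inverse (norm a) - inverse (norm b)) *\<^sub>R b"]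
    by (simp add: divide_inverse mult.commute)
  also have "\<bar>inverse (norm a) - inverse (norm b)\<bar> * norm b = \<bar>norm a - norm b\<bar> / norm a"
  proof -
    have "inverse (norm a) - inverse (norm b) = (norm b - norm a) / (norm a * norm b)"
      using assms False by (simp add: field_simps)
    then show ?thesis using False by (simp add: abs_mult abs_minus_commute)
  qed
  also have "\<dots> \<le> norm (a - b) / norm a"
    by (intro divide_right_mono norm_triangle_ineq3) simp
  finally show ?thesis by simp
qed

text \<open>Cauchy-Schwarz against the all-ones vector.\<close>

lemma sum_component_le_sqrt_card_norm:
  fixes a :: "real ^ 'n"
  shows "(\<Sum>j\<in>UNIV. a $ j) \<le> sqrt (real CARD('n)) * norm a"
proof -
  have "(\<Sum>j\<in>UNIV. a $ j) = a \<bullet> (\<chi> j. 1)"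
    by (simp add: inner_vec_def)
  also have "\<dots> \<le> norm a * norm ((\<chi> j. 1) :: real ^ 'n)"
    by (rule norm_cauchy_schwarz)
  also have "norm ((\<chi> j. 1) :: real ^ 'n) = sqrt (real CARD('n))"
    by (simp add: norm_vec_def L2_set_def)
  finally show ?thesis by (simp add: mult.commute)
qed

text \<open>Counting by indicators over positions makes it possible to swap sums over words and over
  positions.\<close>

lemma multiplicity_of_eq_sum:
  "real (multiplicity_of x j) = (\<Sum>t<length x. of_bool (x ! t = j))"
proof -
  have "{t. t < length x \<and> x ! t = j} = {..<length x} \<inter> {t. x ! t = j}" by auto
  then show ?thesis by (simp add: multiplicity_of_def of_bool_def sum.If_cases)
qed

lemma sum_multiplicity_of:
  fixes x :: "'w::finite list"
  shows "(\<Sum>j\<in>UNIV. real (multiplicity_of x j)) = real (length x)"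
  by (simp add: multiplicity_of_eq_sum sum.swap[of _ "{..<length x}"] of_bool_def)

lemma multiplicity_of_pos_iff: "0 < multiplicity_of x j \<longleftrightarrow> j \<in> set x"
  by (auto simp: multiplicity_of_def card_gt_0_iff in_set_conv_nth)

text \<open>Each position in \<open>S\<close> removes at most one occurrence of an old word and adds
  at most one of a new word, so it contributes at most 2 to the l1 distance of the count
  vectors.\<close>

lemma sum_abs_multiplicity_of_diff_le:
  fixes x y :: "'w::finite list"
  assumes y: "y \<in> perturbations S x" and S: "S \<subseteq> {..<length x}"
  shows "(\<Sum>j\<in>UNIV. \<bar>real (multiplicity_of x j) - real (multiplicity_of y j)\<bar>) \<le> 2 * real (card S)"
proof -
  have len: "length y = length x"
    and eq: "\<And>t. t < length x \<Longrightarrow> t \<notin> S \<Longrightarrow> y ! t = x ! t"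
    using y by (auto simp: perturbations_def documents_def)
  let ?d = "\<lambda>j t. of_bool (x ! t = j) - of_bool (y ! t = j) :: real"
  have "\<bar>real (multiplicity_of x j) - real (multiplicity_of y j)\<bar>
      \<le> (\<Sum>t\<in>S. of_bool (x ! t = j) + of_bool (y ! t = j))" for j
  proof -
    have "real (multiplicity_of x j) - real (multiplicity_of y j) = (\<Sum>t<length x. ?d j t)"
      by (simp add: multiplicity_of_eq_sum len sum_subtractf)
    \<comment> \<open>Outside \<open>S\<close> both documents carry the same word and the indicators
      cancel.\<close>
    also have "\<dots> = (\<Sum>t\<in>S. ?d j t)"
      using S eq by (intro sum.mono_neutral_right) auto
    also have "\<bar>\<dots>\<bar> \<le> (\<Sum>t\<in>S. \<bar>?d j t\<bar>)"
      by (rule sum_abs)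
    also have "\<dots> \<le> (\<Sum>t\<in>S. of_bool (x ! t = j) + of_bool (y ! t = j))"
      by (intro sum_mono) auto
    finally show ?thesis .
  qed
  then have "(\<Sum>j\<in>UNIV. \<bar>real (multiplicity_of x j) - real (multiplicity_of y j)\<bar>)
      \<le> (\<Sum>j\<in>UNIV. \<Sum>t\<in>S. of_bool (x ! t = j) + of_bool (y ! t = j))"
    by (intro sum_mono)
  also have "\<dots> = (\<Sum>t\<in>S. \<Sum>j\<in>UNIV. of_bool (x ! t = j) + of_bool (y ! t = j))"
    by (rule sum.swap)
  also have "\<dots> = 2 * real (card S)"
    by (simp add: sum.distrib of_bool_def)
  finally show ?thesis .
qed

lemma idf_le_max_idf: "idf \<C> j \<le> max_idf \<C>" for j :: "'w::finite"
  by (simp add: max_idf_def)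

text \<open>The Euclidean norm is at most the l1 norm, in which the changed positions can be
  counted; each weight is then replaced by the largest one.\<close>

lemma norm_tfidf_diff_le:
  fixes x y :: "'w::finite list"
  assumes y: "y \<in> perturbations S x" and S: "S \<subseteq> {..<length x}"
    and idf: "\<And>j. 0 \<le> idf \<C> j"
  shows "norm (tfidf \<C> x - tfidf \<C> y) \<le> 2 * max_idf \<C> * (real (card S) / real (length x))"
proof -
  have len: "length y = length x"
    using y by (auto simp: perturbations_def documents_def)
  have v: "0 \<le> max_idf \<C>"
    using idf idf_le_max_idf order_trans by blast
  have "norm (tfidf \<C> x - tfidf \<C> y) \<le> (\<Sum>j\<in>UNIV. \<bar>(tfidf \<C> x - tfidf \<C> y) $ j\<bar>)"
    by (rule norm_le_l1_cart)
  also have "\<dots> \<le> (\<Sum>j\<in>UNIV. max_idf \<C> / real (length x)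
      * \<bar>real (multiplicity_of x j) - real (multiplicity_of y j)\<bar>)"
  proof (rule sum_mono)
    fix j :: 'w
    let ?m = "\<bar>real (multiplicity_of x j) - real (multiplicity_of y j)\<bar>"
    have "(tfidf \<C> x - tfidf \<C> y) $ j
        = idf \<C> j / real (length x) * (real (multiplicity_of x j) - real (multiplicity_of y j))"
      by (simp add: tfidf_def len algebra_simps diff_divide_distrib)
    then have "\<bar>(tfidf \<C> x - tfidf \<C> y) $ j\<bar> = idf \<C> j / real (length x) * ?m"
      using idf[of j] by (simp add: abs_mult)
    also have "\<dots> \<le> max_idf \<C> / real (length x) * ?m"
      by (intro mult_right_mono divide_right_mono idf_le_max_idf) auto
    finally show "\<bar>(tfidf \<C> x - tfidf \<C> y) $ j\<bar> \<le> max_idf \<C> / real (length x) * ?m" .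
  qed
  also have "\<dots> = max_idf \<C> / real (length x)
      * (\<Sum>j\<in>UNIV. \<bar>real (multiplicity_of x j) - real (multiplicity_of y j)\<bar>)"
    by (simp add: sum_distrib_left)
  also have "\<dots> \<le> max_idf \<C> / real (length x) * (2 * real (card S))"
    using v by (intro mult_left_mono sum_abs_multiplicity_of_diff_le y S) auto
  finally show ?thesis by (simp add: mult_ac)
qed

lemma min_idf_le_sqrt_card_norm_tfidf:
  fixes x :: "'w::finite list"
  assumes "x \<noteq> []"
  shows "min_idf \<C> x \<le> sqrt (real CARD('w)) * norm (tfidf \<C> x)"
proof -
  \<comment> \<open>The word frequencies sum to 1, so the minimum is at most the frequency-weighted
    mean of the \<open>idf\<close> values, which is the sum of the components of
    \<open>tfidf \<C> x\<close>.\<close>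
  have "min_idf \<C> x = (\<Sum>j\<in>UNIV. real (multiplicity_of x j)) / real (length x) * min_idf \<C> x"
    using assms by (simp add: sum_multiplicity_of)
  also have "\<dots> = (\<Sum>j\<in>UNIV. real (multiplicity_of x j) / real (length x) * min_idf \<C> x)"
    by (simp add: sum_divide_distrib sum_distrib_right)
  also have "\<dots> \<le> (\<Sum>j\<in>UNIV. tfidf \<C> x $ j)"
  proof (rule sum_mono)
    fix j :: 'w
    show "real (multiplicity_of x j) / real (length x) * min_idf \<C> x \<le> tfidf \<C> x $ j"
    proof (cases "j \<in> set x")
      case True
      then show ?thesis
        by (auto simp: tfidf_def min_idf_def intro!: mult_left_mono divide_right_mono)
    next
      \<comment> \<open>\<open>min_idf\<close> says nothing about words absent from
        \<open>x\<close>, but their frequency is 0.\<close>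
      case False
      then have "multiplicity_of x j = 0" using multiplicity_of_pos_iff[of x j] by simp
      then show ?thesis by (simp add: tfidf_def)
    qed
  qed
  also have "\<dots> \<le> sqrt (real CARD('w)) * norm (tfidf \<C> x)"
    by (rule sum_component_le_sqrt_card_norm)
  finally show ?thesis .
qed

lemma max_multiplicity_ge_1:
  assumes "x \<noteq> []"
  shows "1 \<le> max_multiplicity x"
proof -
  have "0 < multiplicity_of x (hd x)" using assms by (simp add: multiplicity_of_pos_iff)
  also have "\<dots> \<le> max_multiplicity x" by (simp add: max_multiplicity_def)
  finally show ?thesis by simp
qed

theorem proposition4p2:
  fixes \<C> :: "'w::finite list set"
    and T :: nat
    and x y :: "'w list"
    and S :: "nat set"
  assumes "valid_corpus \<C>"
    and "T \<ge> 1"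
    and "x \<in> documents T"
    and "S \<subseteq> {..<T}"
    and "real (card S) \<le>
           real T * norm (tfidf \<C> x) / (4 * real (max_multiplicity x) * max_idf \<C>)"
    and "y \<in> perturbations S x"
  shows "norm (normalized_tfidf \<C> x - normalized_tfidf \<C> y) \<le>
           4 * real (max_multiplicity x) powr (1/2) * max_idf \<C> powr (1/2)
             * real CARD('w) powr (1/4) / min_idf \<C> x powr (1/2)
             * sqrt (real (card S) / real T)"
proof -
  have len: "length x = T" using assms(3) by (simp add: documents_def)
  then have ne: "x \<noteq> []" using assms(2) by auto
  have idf: "0 < idf \<C> j" for j using assms(1) by (simp add: valid_corpus_def)
  define v where "v = max_idf \<C>"
  define u where "u = min_idf \<C> x"
  define m where "m = real (max_multiplicity x)"
  define r where "r = real (card S) / real T"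
  define n where "n = norm (tfidf \<C> x)"
  define D where "D = real CARD('w)"
  define q where "q = 4 * v * r / n"
  have v: "0 < v" unfolding v_def using idf idf_le_max_idf less_le_trans by blast
  have u: "0 < u" unfolding u_def min_idf_def using ne idf by (subst Min_gr_iff) auto
  have m: "1 \<le> m" unfolding m_def using max_multiplicity_ge_1[OF ne] by simp
  have r: "0 \<le> r" by (simp add: r_def)
  have D: "0 < D" by (simp add: D_def)
  have un: "u \<le> sqrt D * n"
    unfolding u_def D_def n_def by (rule min_idf_le_sqrt_card_norm_tfidf[OF ne])
  \<comment> \<open>The lower bound on the norm also shows that the transform of \<open>x\<close>
    can be normalized.\<close>
  then have n: "0 < n" using u D by (metis less_le_trans real_sqrt_gt_0_iff zero_less_mult_pos)
  have q0: "0 \<le> q" using v r n by (simp add: q_def)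
  have "r \<le> n / (4 * m * v)"
    using assms(2,5) by (simp add: r_def n_def m_def v_def field_simps)
  then have "m * q \<le> 1" using v m n by (simp add: q_def field_simps)
  then have q1: "q \<le> 1" using m q0 mult_right_mono[of 1 m q] by simp
  have "norm (normalized_tfidf \<C> x - normalized_tfidf \<C> y)
      \<le> 2 * norm (tfidf \<C> x - tfidf \<C> y) / n"
    unfolding normalized_tfidf_def n_def using n by (intro norm_diff_normalized_le) (auto simp: n_def)
  also have "\<dots> \<le> 2 * (2 * v * r) / n"
    using norm_tfidf_diff_le[OF assms(6), of \<C>] assms(4) idf n
    by (intro divide_right_mono mult_left_mono) (auto simp: len v_def r_def less_imp_le)
  also have "\<dots> = q" by (simp add: q_def)
  \<comment> \<open>This passage trades the linear rate in \<open>r\<close> for the square root in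
    the claim.\<close>
  also have "\<dots> \<le> sqrt q"
    using q0 q1 by (intro real_le_rsqrt) (simp add: power2_eq_square mult_left_le)
  also have "\<dots> \<le> sqrt (16 * m * v * sqrt D / u * r)"
  proof (rule real_sqrt_le_mono)
    have "1 / n \<le> sqrt D / u" using un u n by (simp add: field_simps)
    \<comment> \<open>Deliberate slack: after the root, 16 gives the constant 4 and \<open>m\<close>
      gives the factor \<open>m powr (1/2)\<close> of the stated bound.\<close>
    moreover have "4 * v * r \<le> 16 * m * v * r" using m v r by (intro mult_right_mono) auto
    ultimately have "4 * v * r * (1 / n) \<le> 16 * m * v * r * (sqrt D / u)"
      using v r n m by (intro mult_mono) auto
    then show "q \<le> 16 * m * v * sqrt D / u * r" by (simp add: q_def mult_ac)
  qed
  also have "\<dots> = 4 * m powr (1/2) * v powr (1/2) * D powr (1/4) / u powr (1/2) * sqrt r"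
  proof -
    have "sqrt (sqrt D) = D powr (1/4)"
      using D by (simp add: powr_half_sqrt[symmetric] powr_powr)
    then show ?thesis
      using m v u by (simp add: real_sqrt_mult real_sqrt_divide powr_half_sqrt)
  qed
  finally show ?thesis unfolding m_def v_def D_def u_def r_def .
qed

end
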